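(* Let $L$ be a Lie algebra over a field $\mathbb{F}$ such that $L/L^2$ is finite dimensional. Then $$Z^{\wedge}(L)\cap L^2=Z^{\otimes}(L).$$
   Context: Lie algebras are over a fixed field $\mathbb{F}$, not necessarily finite dimensional. $L^2=[L,L]$ denotes the derived subalgebra of $L$. The (nonabelian) tensor square $L\otimes L$ of $L$ is the Lie algebra over $\mathbb{F}$ generated by symbols $l\otimes k$ ($l,k\in L$) subject to the relations, for all $c\in\mathbb{F}$ and $l,l',k,k'\in L$: (i) $c(l\otimes k)=cl\otimes k=l\otimes ck$; (ii) $(l+l')\otimes k=l\otimes k+l'\otimes k$ and $l\otimes(k+k')=l\otimes k+l\otimes k'$; (iii) $[l,l']\otimes k=l\otimes[l',k]-l'\otimes[l,k]$ and $l\otimes[k,k']=[k',l]\otimes k-[k,l]\otimes k'$; (iv) $[\,l\otimes k,\;l'\otimes k'\,]=-[k,l]\otimes[l',k']$. $L\,\square\, L$ is the submodule of $L\otimes L$ generated by all elements $l\otimes l$, $l\in L$ (it is an ideal). The exterior square of $L$ is the quotient $L\wedge L=(L\otimes L)/(L\,\square\, L)$, and $l\wedge l'$ denotes the coset of $l\otimes l'$. The tensor center and exterior center of $L$ are, respectively, $$Z^{\otimes}(L)=\{\,l\in L\mid l\otimes l'=0 \text{ in } L\otimes L\text{ for all } l'\in L\,\},\qquad Z^{\wedge}(L)=\{\,l\in L\mid l\wedge l'=0 \text{ in } L\wedge L\text{ for all } l'\in L\,\}.$$ *)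

theory Defs
  imports "HOL-Algebra.Module" "HOL-Algebra.QuotRing"
begin

section \<open>Lie algebras over a field\<close>

text \<open>
  A Lie algebra is a module record extended by a bracket. The fields \<open>mult\<close> and \<open>one\<close>, which
  every module record inherits from ring records, carry no meaning here.
\<close>

record ('a, 'b) lie = "('a, 'b) module" +
  bracket :: "'b \<Rightarrow> 'b \<Rightarrow> 'b" (\<open>\<langle>_,/ _\<rangle>\<index>\<close>)

locale lie_algebra = F?: field F + L?: module F L
  for F :: "('a, 'r) ring_scheme" (structure) and L :: "('a, 'b, 'm) lie_scheme" (structure) +
  assumes bracket_closed [simp, intro]:
      "\<lbrakk>x \<in> carrier L; y \<in> carrier L\<rbrakk> \<Longrightarrow> \<langle>x, y\<rangle>\<^bsub>L\<^esub> \<in> carrier L"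
    and bracket_add_left:
      "\<lbrakk>x \<in> carrier L; y \<in> carrier L; z \<in> carrier L\<rbrakk> \<Longrightarrow>
       \<langle>x \<oplus>\<^bsub>L\<^esub> y, z\<rangle>\<^bsub>L\<^esub> = \<langle>x, z\<rangle>\<^bsub>L\<^esub> \<oplus>\<^bsub>L\<^esub> \<langle>y, z\<rangle>\<^bsub>L\<^esub>"
    and bracket_add_right:
      "\<lbrakk>x \<in> carrier L; y \<in> carrier L; z \<in> carrier L\<rbrakk> \<Longrightarrow>
       \<langle>x, y \<oplus>\<^bsub>L\<^esub> z\<rangle>\<^bsub>L\<^esub> = \<langle>x, y\<rangle>\<^bsub>L\<^esub> \<oplus>\<^bsub>L\<^esub> \<langle>x, z\<rangle>\<^bsub>L\<^esub>"
    and bracket_smult_left: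
      "\<lbrakk>c \<in> carrier F; x \<in> carrier L; y \<in> carrier L\<rbrakk> \<Longrightarrow>
       \<langle>c \<odot>\<^bsub>L\<^esub> x, y\<rangle>\<^bsub>L\<^esub> = c \<odot>\<^bsub>L\<^esub> \<langle>x, y\<rangle>\<^bsub>L\<^esub>"
    and bracket_smult_right:
      "\<lbrakk>c \<in> carrier F; x \<in> carrier L; y \<in> carrier L\<rbrakk> \<Longrightarrow>
       \<langle>x, c \<odot>\<^bsub>L\<^esub> y\<rangle>\<^bsub>L\<^esub> = c \<odot>\<^bsub>L\<^esub> \<langle>x, y\<rangle>\<^bsub>L\<^esub>"
    and bracket_self:
      "x \<in> carrier L \<Longrightarrow> \<langle>x, x\<rangle>\<^bsub>L\<^esub> = \<zero>\<^bsub>L\<^esub>"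
    and jacobi:
      "\<lbrakk>x \<in> carrier L; y \<in> carrier L; z \<in> carrier L\<rbrakk> \<Longrightarrow>
       \<langle>x, \<langle>y, z\<rangle>\<^bsub>L\<^esub>\<rangle>\<^bsub>L\<^esub> \<oplus>\<^bsub>L\<^esub> \<langle>y, \<langle>z, x\<rangle>\<^bsub>L\<^esub>\<rangle>\<^bsub>L\<^esub> \<oplus>\<^bsub>L\<^esub> \<langle>z, \<langle>x, y\<rangle>\<^bsub>L\<^esub>\<rangle>\<^bsub>L\<^esub> = \<zero>\<^bsub>L\<^esub>"

definition submodule_generated ::
    "('a, 'r) ring_scheme \<Rightarrow> ('a, 'b, 'm) module_scheme \<Rightarrow> 'b set \<Rightarrow> 'b set" where
  "submodule_generated F M S = \<Inter>{H. submodule H F M \<and> S \<subseteq> H}"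

definition finite_dimensional ::
    "('a, 'r) ring_scheme \<Rightarrow> ('a, 'b, 'm) module_scheme \<Rightarrow> bool" where
  "finite_dimensional F M \<longleftrightarrow>
     (\<exists>S. finite S \<and> S \<subseteq> carrier M \<and> submodule_generated F M S = carrier M)"

definition derived_subalgebra ::
    "('a, 'r) ring_scheme \<Rightarrow> ('a, 'b, 'm) lie_scheme \<Rightarrow> 'b set" where
  "derived_subalgebra F L =
     submodule_generated F L {\<langle>x, y\<rangle>\<^bsub>L\<^esub> | x y. x \<in> carrier L \<and> y \<in> carrier L}"

text \<open>
  The quotient by an ideal, on additive cosets. The operations are given by unions over all
  representatives, as in \<^const>\<open>rcoset_mult\<close>; for an ideal \<open>I\<close> these unions are single cosets.
\<close>

definition lie_quotient ::
    "('a, 'b, 'm) lie_scheme \<Rightarrow> 'b set \<Rightarrow> ('a, 'b set) lie" where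
  "lie_quotient L I =
    \<lparr>carrier = a_rcosets\<^bsub>L\<^esub> I, mult = undefined, one = undefined,
     zero = I, add = set_add L,
     smult = (\<lambda>c U. \<Union>x\<in>U. I +>\<^bsub>L\<^esub> (c \<odot>\<^bsub>L\<^esub> x)),
     bracket = (\<lambda>U V. \<Union>x\<in>U. \<Union>y\<in>V. I +>\<^bsub>L\<^esub> \<langle>x, y\<rangle>\<^bsub>L\<^esub>)\<rparr>"


section \<open>Lie algebras given by generators and relations\<close>

text \<open>
  The Lie algebra over \<open>F\<close> generated by a set \<open>G\<close> of symbols subject to a set \<open>E\<close> of equations
  between Lie expressions in these symbols: formal expressions modulo the least congruence that
  contains \<open>E\<close> and enforces the axioms of a Lie algebra over \<open>F\<close>.
\<close>

datatype ('a, 'g) lie_expr =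
    Gen 'g
  | Zero
  | Plus "('a, 'g) lie_expr" "('a, 'g) lie_expr"
  | Scale 'a "('a, 'g) lie_expr"
  | Brack "('a, 'g) lie_expr" "('a, 'g) lie_expr"

inductive_set lie_exprs :: "('a, 'r) ring_scheme \<Rightarrow> 'g set \<Rightarrow> ('a, 'g) lie_expr set"
  for F :: "('a, 'r) ring_scheme" and G :: "'g set" where
  Gen: "g \<in> G \<Longrightarrow> Gen g \<in> lie_exprs F G"
| Zero: "Zero \<in> lie_exprs F G"
| Plus: "\<lbrakk>s \<in> lie_exprs F G; t \<in> lie_exprs F G\<rbrakk> \<Longrightarrow> Plus s t \<in> lie_exprs F G"
| Scale: "\<lbrakk>c \<in> carrier F; s \<in> lie_exprs F G\<rbrakk> \<Longrightarrow> Scale c s \<in> lie_exprs F G"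
| Brack: "\<lbrakk>s \<in> lie_exprs F G; t \<in> lie_exprs F G\<rbrakk> \<Longrightarrow> Brack s t \<in> lie_exprs F G"

definition Neg :: "('a, 'r) ring_scheme \<Rightarrow> ('a, 'g) lie_expr \<Rightarrow> ('a, 'g) lie_expr" where
  "Neg F s = Scale (\<ominus>\<^bsub>F\<^esub> \<one>\<^bsub>F\<^esub>) s"

inductive_set lie_cong ::
    "('a, 'r) ring_scheme \<Rightarrow> 'g set \<Rightarrow> (('a, 'g) lie_expr \<times> ('a, 'g) lie_expr) set \<Rightarrow>
     (('a, 'g) lie_expr \<times> ('a, 'g) lie_expr) set"
  for F :: "('a, 'r) ring_scheme" (structure) and G :: "'g set"
    and E :: "(('a, 'g) lie_expr \<times> ('a, 'g) lie_expr) set" where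
  relation: "\<lbrakk>(s, t) \<in> E; s \<in> lie_exprs F G; t \<in> lie_exprs F G\<rbrakk> \<Longrightarrow> (s, t) \<in> lie_cong F G E"
| refl: "s \<in> lie_exprs F G \<Longrightarrow> (s, s) \<in> lie_cong F G E"
| sym: "(s, t) \<in> lie_cong F G E \<Longrightarrow> (t, s) \<in> lie_cong F G E"
| trans: "\<lbrakk>(s, t) \<in> lie_cong F G E; (t, u) \<in> lie_cong F G E\<rbrakk> \<Longrightarrow> (s, u) \<in> lie_cong F G E"
| Plus_cong: "\<lbrakk>(s, s') \<in> lie_cong F G E; (t, t') \<in> lie_cong F G E\<rbrakk> \<Longrightarrow>
    (Plus s t, Plus s' t') \<in> lie_cong F G E"
| Scale_cong: "\<lbrakk>c \<in> carrier F; (s, s') \<in> lie_cong F G E\<rbrakk> \<Longrightarrow>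
    (Scale c s, Scale c s') \<in> lie_cong F G E"
| Brack_cong: "\<lbrakk>(s, s') \<in> lie_cong F G E; (t, t') \<in> lie_cong F G E\<rbrakk> \<Longrightarrow>
    (Brack s t, Brack s' t') \<in> lie_cong F G E"
| Plus_assoc: "\<lbrakk>s \<in> lie_exprs F G; t \<in> lie_exprs F G; u \<in> lie_exprs F G\<rbrakk> \<Longrightarrow>
    (Plus (Plus s t) u, Plus s (Plus t u)) \<in> lie_cong F G E"
| Plus_commute: "\<lbrakk>s \<in> lie_exprs F G; t \<in> lie_exprs F G\<rbrakk> \<Longrightarrow>
    (Plus s t, Plus t s) \<in> lie_cong F G E"
| Plus_Zero: "s \<in> lie_exprs F G \<Longrightarrow> (Plus s Zero, s) \<in> lie_cong F G E"
| Plus_Neg: "s \<in> lie_exprs F G \<Longrightarrow> (Plus s (Neg F s), Zero) \<in> lie_cong F G E"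
| Scale_add: "\<lbrakk>c \<in> carrier F; d \<in> carrier F; s \<in> lie_exprs F G\<rbrakk> \<Longrightarrow>
    (Scale (c \<oplus> d) s, Plus (Scale c s) (Scale d s)) \<in> lie_cong F G E"
| Scale_Plus: "\<lbrakk>c \<in> carrier F; s \<in> lie_exprs F G; t \<in> lie_exprs F G\<rbrakk> \<Longrightarrow>
    (Scale c (Plus s t), Plus (Scale c s) (Scale c t)) \<in> lie_cong F G E"
| Scale_mult: "\<lbrakk>c \<in> carrier F; d \<in> carrier F; s \<in> lie_exprs F G\<rbrakk> \<Longrightarrow>
    (Scale (c \<otimes> d) s, Scale c (Scale d s)) \<in> lie_cong F G E"
| Scale_one: "s \<in> lie_exprs F G \<Longrightarrow> (Scale \<one> s, s) \<in> lie_cong F G E"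
| Brack_Plus_left: "\<lbrakk>s \<in> lie_exprs F G; t \<in> lie_exprs F G; u \<in> lie_exprs F G\<rbrakk> \<Longrightarrow>
    (Brack (Plus s t) u, Plus (Brack s u) (Brack t u)) \<in> lie_cong F G E"
| Brack_Plus_right: "\<lbrakk>s \<in> lie_exprs F G; t \<in> lie_exprs F G; u \<in> lie_exprs F G\<rbrakk> \<Longrightarrow>
    (Brack s (Plus t u), Plus (Brack s t) (Brack s u)) \<in> lie_cong F G E"
| Brack_Scale_left: "\<lbrakk>c \<in> carrier F; s \<in> lie_exprs F G; t \<in> lie_exprs F G\<rbrakk> \<Longrightarrow>
    (Brack (Scale c s) t, Scale c (Brack s t)) \<in> lie_cong F G E"
| Brack_Scale_right: "\<lbrakk>c \<in> carrier F; s \<in> lie_exprs F G; t \<in> lie_exprs F G\<rbrakk> \<Longrightarrow>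
    (Brack s (Scale c t), Scale c (Brack s t)) \<in> lie_cong F G E"
| Brack_self: "s \<in> lie_exprs F G \<Longrightarrow> (Brack s s, Zero) \<in> lie_cong F G E"
| Jacobi: "\<lbrakk>s \<in> lie_exprs F G; t \<in> lie_exprs F G; u \<in> lie_exprs F G\<rbrakk> \<Longrightarrow>
    (Plus (Plus (Brack s (Brack t u)) (Brack t (Brack u s))) (Brack u (Brack s t)), Zero)
      \<in> lie_cong F G E"

definition lie_presented ::
    "('a, 'r) ring_scheme \<Rightarrow> 'g set \<Rightarrow> (('a, 'g) lie_expr \<times> ('a, 'g) lie_expr) set \<Rightarrow>
     ('a, ('a, 'g) lie_expr set) lie" where
  "lie_presented F G E =
    \<lparr>carrier = lie_exprs F G // lie_cong F G E, mult = undefined, one = undefined,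
     zero = lie_cong F G E `` {Zero},
     add = (\<lambda>A B. lie_cong F G E `` {Plus s t | s t. s \<in> A \<and> t \<in> B}),
     smult = (\<lambda>c A. lie_cong F G E `` {Scale c s | s. s \<in> A}),
     bracket = (\<lambda>A B. lie_cong F G E `` {Brack s t | s t. s \<in> A \<and> t \<in> B})\<rparr>"


section \<open>The nonabelian tensor square and the exterior square\<close>

text \<open>The symbol $l \otimes k$ is represented by the generator \<open>Gen (l, k)\<close>.\<close>

inductive_set tensor_relations ::
    "('a, 'r) ring_scheme \<Rightarrow> ('a, 'b, 'm) lie_scheme \<Rightarrow>
     (('a, 'b \<times> 'b) lie_expr \<times> ('a, 'b \<times> 'b) lie_expr) set"
  for F :: "('a, 'r) ring_scheme" and L :: "('a, 'b, 'm) lie_scheme" (structure) where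
  scale_left: "\<lbrakk>c \<in> carrier F; l \<in> carrier L; k \<in> carrier L\<rbrakk> \<Longrightarrow>
    (Scale c (Gen (l, k)), Gen (c \<odot> l, k)) \<in> tensor_relations F L"
| scale_right: "\<lbrakk>c \<in> carrier F; l \<in> carrier L; k \<in> carrier L\<rbrakk> \<Longrightarrow>
    (Scale c (Gen (l, k)), Gen (l, c \<odot> k)) \<in> tensor_relations F L"
| add_left: "\<lbrakk>l \<in> carrier L; l' \<in> carrier L; k \<in> carrier L\<rbrakk> \<Longrightarrow>
    (Gen (l \<oplus> l', k), Plus (Gen (l, k)) (Gen (l', k))) \<in> tensor_relations F L"
| add_right: "\<lbrakk>l \<in> carrier L; k \<in> carrier L; k' \<in> carrier L\<rbrakk> \<Longrightarrow>
    (Gen (l, k \<oplus> k'), Plus (Gen (l, k)) (Gen (l, k'))) \<in> tensor_relations F L"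
| bracket_left: "\<lbrakk>l \<in> carrier L; l' \<in> carrier L; k \<in> carrier L\<rbrakk> \<Longrightarrow>
    (Gen (\<langle>l, l'\<rangle>, k), Plus (Gen (l, \<langle>l', k\<rangle>)) (Neg F (Gen (l', \<langle>l, k\<rangle>)))) \<in> tensor_relations F L"
| bracket_right: "\<lbrakk>l \<in> carrier L; k \<in> carrier L; k' \<in> carrier L\<rbrakk> \<Longrightarrow>
    (Gen (l, \<langle>k, k'\<rangle>), Plus (Gen (\<langle>k', l\<rangle>, k)) (Neg F (Gen (\<langle>k, l\<rangle>, k')))) \<in> tensor_relations F L"
| bracket_bracket: "\<lbrakk>l \<in> carrier L; k \<in> carrier L; l' \<in> carrier L; k' \<in> carrier L\<rbrakk> \<Longrightarrow>
    (Brack (Gen (l, k)) (Gen (l', k')), Neg F (Gen (\<langle>k, l\<rangle>, \<langle>l', k'\<rangle>))) \<in> tensor_relations F L"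

definition tensor_square ::
    "('a, 'r) ring_scheme \<Rightarrow> ('a, 'b, 'm) lie_scheme \<Rightarrow>
     ('a, ('a, 'b \<times> 'b) lie_expr set) lie" where
  "tensor_square F L = lie_presented F (carrier L \<times> carrier L) (tensor_relations F L)"

definition tensor ::
    "('a, 'r) ring_scheme \<Rightarrow> ('a, 'b, 'm) lie_scheme \<Rightarrow> 'b \<Rightarrow> 'b \<Rightarrow>
     ('a, 'b \<times> 'b) lie_expr set" where
  "tensor F L l k =
     lie_cong F (carrier L \<times> carrier L) (tensor_relations F L) `` {Gen (l, k)}"

definition tensor_diagonal ::
    "('a, 'r) ring_scheme \<Rightarrow> ('a, 'b, 'm) lie_scheme \<Rightarrow> ('a, 'b \<times> 'b) lie_expr set set" where
  "tensor_diagonal F L =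
     submodule_generated F (tensor_square F L) {tensor F L l l | l. l \<in> carrier L}"

definition exterior_square ::
    "('a, 'r) ring_scheme \<Rightarrow> ('a, 'b, 'm) lie_scheme \<Rightarrow>
     ('a, ('a, 'b \<times> 'b) lie_expr set set) lie" where
  "exterior_square F L = lie_quotient (tensor_square F L) (tensor_diagonal F L)"

definition wedge ::
    "('a, 'r) ring_scheme \<Rightarrow> ('a, 'b, 'm) lie_scheme \<Rightarrow> 'b \<Rightarrow> 'b \<Rightarrow>
     ('a, 'b \<times> 'b) lie_expr set set" where
  "wedge F L l k = tensor_diagonal F L +>\<^bsub>tensor_square F L\<^esub> tensor F L l k"

definition tensor_center ::
    "('a, 'r) ring_scheme \<Rightarrow> ('a, 'b, 'm) lie_scheme \<Rightarrow> 'b set" where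
  "tensor_center F L =
     {l \<in> carrier L. \<forall>l'\<in>carrier L. tensor F L l l' = \<zero>\<^bsub>tensor_square F L\<^esub>}"

definition exterior_center ::
    "('a, 'r) ring_scheme \<Rightarrow> ('a, 'b, 'm) lie_scheme \<Rightarrow> 'b set" where
  "exterior_center F L =
     {l \<in> carrier L. \<forall>l'\<in>carrier L. wedge F L l l' = \<zero>\<^bsub>exterior_square F L\<^esub>}"

end

theory Submission
  imports Defs
begin

text \<open>
  Write $D = L^2$. Relations (iii) force $d \otimes y + y \otimes d = 0$ for $d \in D$, and (iv) forces
  $d \otimes d = 0$; hence \<open>x \<mapsto> x \<otimes> x\<close> depends only on \<open>x\<close> modulo \<open>D\<close>. On the other hand, two linear
  forms \<open>f, g\<close> on \<open>L\<close> that vanish on \<open>D\<close> induce a linear form on $L \otimes L$ with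
  $l \otimes k \mapsto f(l)\, g(k)$ that kills all brackets. These forms separate the elements of
  $L \,\square\, L$, as one sees by adjoining finitely many vectors to \<open>D\<close> one at a time, and they all
  vanish on $l \otimes k$ when $l \in D$; so for such \<open>l\<close>, $l \wedge k = 0$ implies $l \otimes k = 0$.
  If $l \notin D$, a form with \<open>f l = 1\<close> shows $l \otimes l \neq 0$.
\<close>

section \<open>Submodules and linear forms\<close>

context module
begin

text \<open>Negatives come for free because \<open>-a = (-1) a\<close>, so zero and closure under
  sums and scalar multiples are enough.\<close>

lemma submoduleI':
  assumes "H \<subseteq> carrier M" "\<zero>\<^bsub>M\<^esub> \<in> H"
    and "\<And>a b. \<lbrakk>a \<in> H; b \<in> H\<rbrakk> \<Longrightarrow> a \<oplus>\<^bsub>M\<^esub> b \<in> H"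
    and smult: "\<And>a x. \<lbrakk>a \<in> carrier R; x \<in> H\<rbrakk> \<Longrightarrow> a \<odot>\<^bsub>M\<^esub> x \<in> H"
  shows "submodule H R M"
proof (rule submoduleI)
  fix a assume "a \<in> H"
  moreover from this have "\<ominus>\<^bsub>M\<^esub> a = (\<ominus> \<one>) \<odot>\<^bsub>M\<^esub> a"
    using assms(1) by (subst smult_l_minus) auto
  ultimately show "\<ominus>\<^bsub>M\<^esub> a \<in> H" by (simp add: smult)
qed (use assms in auto)

lemma submodule_zero: "submodule H R M \<Longrightarrow> \<zero>\<^bsub>M\<^esub> \<in> H"
  using subgroup.one_closed[OF submodule.axioms(1)] by fastforce

lemma submodule_generated_is_submodule:
  assumes "S \<subseteq> carrier M"
  shows "submodule (submodule_generated R M S) R M"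
proof (rule submoduleI')
  show "submodule_generated R M S \<subseteq> carrier M"
    unfolding submodule_generated_def using carrier_is_submodule assms by blast
qed (auto simp: submodule_generated_def submodule_zero submoduleE)

lemma submodule_generated_superset: "S \<subseteq> submodule_generated R M S"
  unfolding submodule_generated_def by blast

lemma submodule_generated_least:
  "\<lbrakk>submodule H R M; S \<subseteq> H\<rbrakk> \<Longrightarrow> submodule_generated R M S \<subseteq> H"
  unfolding submodule_generated_def by blast

lemma submodule_generated_mono:
  "S \<subseteq> S' \<Longrightarrow> submodule_generated R M S \<subseteq> submodule_generated R M S'"
  unfolding submodule_generated_def by blast

section \<open>Adjoining a vector to a submodule\<close>

definition adjoin :: "'c set \<Rightarrow> 'c \<Rightarrow> 'c set" where
  "adjoin N e = {m \<oplus>\<^bsub>M\<^esub> c \<odot>\<^bsub>M\<^esub> e | m c. m \<in> N \<and> c \<in> carrier R}"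

lemma adjoinI: "\<lbrakk>m \<in> N; c \<in> carrier R\<rbrakk> \<Longrightarrow> m \<oplus>\<^bsub>M\<^esub> c \<odot>\<^bsub>M\<^esub> e \<in> adjoin N e"
  unfolding adjoin_def by blast

lemma adjoin_submodule:
  assumes N: "submodule N R M" and e: "e \<in> carrier M"
  shows "submodule (adjoin N e) R M"
proof (rule submoduleI')
  note [simp] = submodule_zero[OF N] submoduleE(3-5)[OF N]
  have [simp]: "m \<in> carrier M" if "m \<in> N" for m
    using that submoduleE(1)[OF N] by blast
  show "adjoin N e \<subseteq> carrier M"
    using e by (auto simp: adjoin_def)
  show "\<zero>\<^bsub>M\<^esub> \<in> adjoin N e"
    using adjoinI[of "\<zero>\<^bsub>M\<^esub>" N \<zero> e] e by simp
  fix a b assume "a \<in> adjoin N e" "b \<in> adjoin N e"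
  then obtain m c n d where mn: "m \<in> N" "n \<in> N" "c \<in> carrier R" "d \<in> carrier R"
      and ab: "a = m \<oplus>\<^bsub>M\<^esub> c \<odot>\<^bsub>M\<^esub> e" "b = n \<oplus>\<^bsub>M\<^esub> d \<odot>\<^bsub>M\<^esub> e"
    unfolding adjoin_def by blast
  have "a \<oplus>\<^bsub>M\<^esub> b = (m \<oplus>\<^bsub>M\<^esub> n) \<oplus>\<^bsub>M\<^esub> (c \<oplus> d) \<odot>\<^bsub>M\<^esub> e"
    unfolding ab using mn e by (simp add: smult_l_distr M.a_ac)
  then show "a \<oplus>\<^bsub>M\<^esub> b \<in> adjoin N e" using mn by (simp add: adjoinI)
next
  note [simp] = submoduleE(3-5)[OF N]
  have [simp]: "m \<in> carrier M" if "m \<in> N" for m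
    using that submoduleE(1)[OF N] by blast
  fix a x assume a: "a \<in> carrier R" and "x \<in> adjoin N e"
  then obtain m c where m: "m \<in> N" "c \<in> carrier R" "x = m \<oplus>\<^bsub>M\<^esub> c \<odot>\<^bsub>M\<^esub> e"
    unfolding adjoin_def by blast
  then have "a \<odot>\<^bsub>M\<^esub> x = a \<odot>\<^bsub>M\<^esub> m \<oplus>\<^bsub>M\<^esub> (a \<otimes> c) \<odot>\<^bsub>M\<^esub> e"
    using a e by (simp add: smult_r_distr smult_assoc1)
  then show "a \<odot>\<^bsub>M\<^esub> x \<in> adjoin N e" using m a by (simp add: adjoinI)
qed

lemma adjoin_superset:
  assumes "submodule N R M" "e \<in> carrier M"
  shows "N \<subseteq> adjoin N e"
proof
  fix m assume "m \<in> N"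
  then show "m \<in> adjoin N e"
    using adjoinI[of m N \<zero> e] assms submoduleE(1)[OF assms(1)] by auto
qed

lemma adjoin_self:
  assumes "submodule N R M" "e \<in> carrier M"
  shows "e \<in> adjoin N e"
  using adjoinI[of "\<zero>\<^bsub>M\<^esub>" N \<one> e] assms by (simp add: submodule_zero)

section \<open>Linear forms and their kernels\<close>

definition linear_form :: "('c \<Rightarrow> 'a) \<Rightarrow> bool" where
  "linear_form f \<longleftrightarrow> f \<in> carrier M \<rightarrow> carrier R \<and>
     (\<forall>x\<in>carrier M. \<forall>y\<in>carrier M. f (x \<oplus>\<^bsub>M\<^esub> y) = f x \<oplus> f y) \<and>
     (\<forall>c\<in>carrier R. \<forall>x\<in>carrier M. f (c \<odot>\<^bsub>M\<^esub> x) = c \<otimes> f x)"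

lemma linear_form_closed: "\<lbrakk>linear_form f; x \<in> carrier M\<rbrakk> \<Longrightarrow> f x \<in> carrier R"
  and linear_form_add:
    "\<lbrakk>linear_form f; x \<in> carrier M; y \<in> carrier M\<rbrakk> \<Longrightarrow> f (x \<oplus>\<^bsub>M\<^esub> y) = f x \<oplus> f y"
  and linear_form_smult:
    "\<lbrakk>linear_form f; c \<in> carrier R; x \<in> carrier M\<rbrakk> \<Longrightarrow> f (c \<odot>\<^bsub>M\<^esub> x) = c \<otimes> f x"
  unfolding linear_form_def by auto

lemma linear_form_zero: "linear_form f \<Longrightarrow> f \<zero>\<^bsub>M\<^esub> = \<zero>"
  using linear_form_smult[of f \<zero> "\<zero>\<^bsub>M\<^esub>"] linear_form_closed[of f "\<zero>\<^bsub>M\<^esub>"] by simp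

lemma linear_form_kernel_submodule:
  "linear_form f \<Longrightarrow> submodule {x \<in> carrier M. f x = \<zero>} R M"
  by (rule submoduleI') (auto simp: linear_form_zero linear_form_add linear_form_smult)

lemma linear_form_vanishes_on_generated:
  assumes "linear_form f" "S \<subseteq> carrier M" "\<And>x. x \<in> S \<Longrightarrow> f x = \<zero>"
    and "x \<in> submodule_generated R M S"
  shows "f x = \<zero>"
  using submodule_generated_least[OF linear_form_kernel_submodule[OF assms(1)], of S] assms(2-4)
  by blast

text \<open>Zorn's lemma for the submodules that contain \<open>N\<close> and avoid
  \<open>x\<close>: the union of a nonempty chain is again one, since any two members are
  comparable. This takes the place of choosing a basis in possibly infinite dimension.\<close>

lemma ex_maximal_submodule_avoiding:
  assumes N: "submodule N R M" and x: "x \<notin> N"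
  shows "\<exists>K. submodule K R M \<and> N \<subseteq> K \<and> x \<notin> K \<and>
           (\<forall>H. submodule H R M \<and> K \<subseteq> H \<and> x \<notin> H \<longrightarrow> H = K)"
proof -
  let ?A = "{H. submodule H R M \<and> N \<subseteq> H \<and> x \<notin> H}"
  have "\<exists>K\<in>?A. \<forall>X\<in>?A. K \<subseteq> X \<longrightarrow> X = K"
  proof (rule subset_Zorn_nonempty)
    show "?A \<noteq> {}" using assms by blast
    fix C assume C: "C \<noteq> {}" "subset.chain ?A C"
    then have sub: "submodule H R M" "N \<subseteq> H" "x \<notin> H" if "H \<in> C" for H
      using that unfolding subset.chain_def by auto
    have "submodule (\<Union>C) R M"
    proof (rule submoduleI')
      show "\<Union>C \<subseteq> carrier M" using sub(1) submoduleE(1) by blast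
      show "\<zero>\<^bsub>M\<^esub> \<in> \<Union>C" using sub(1) C(1) submodule_zero by blast
      show "a \<oplus>\<^bsub>M\<^esub> b \<in> \<Union>C" if "a \<in> \<Union>C" "b \<in> \<Union>C" for a b
      proof -
        from that obtain H H' where H: "H \<in> C" "H' \<in> C" "a \<in> H" "b \<in> H'" by blast
        moreover from H have "H \<subseteq> H' \<or> H' \<subseteq> H"
          using C(2) unfolding subset_chain_def by blast
        ultimately obtain K where "K \<in> C" "a \<in> K" "b \<in> K" by blast
        then show ?thesis using sub(1) submoduleE(5) by blast
      qed
      show "c \<odot>\<^bsub>M\<^esub> a \<in> \<Union>C" if "c \<in> carrier R" "a \<in> \<Union>C" for c a
        using that sub(1) submoduleE(4) by blast
    qed
    then show "\<Union>C \<in> ?A" using C(1) sub by blast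
  qed
  then obtain K where K: "K \<in> ?A" "\<And>H. \<lbrakk>H \<in> ?A; K \<subseteq> H\<rbrakk> \<Longrightarrow> H = K"
    by meson
  have "H = K" if "submodule H R M \<and> K \<subseteq> H \<and> x \<notin> H" for H
    using that K(1) by (intro K(2)) auto
  with K(1) show ?thesis by blast
qed

text \<open>
  A maximal submodule \<open>K\<close> among those containing \<open>N\<close> but not \<open>x\<close> is a complement of the line
  through \<open>x\<close>; the form is the coordinate along this line.
\<close>

lemma ex_separating_linear_form:
  assumes "field R" and N: "submodule N R M" and x: "x \<in> carrier M" "x \<notin> N"
  shows "\<exists>f. linear_form f \<and> (\<forall>y\<in>N. f y = \<zero>) \<and> f x = \<one>"
proof -
  interpret R: field R by fact
  obtain K where K: "submodule K R M" "N \<subseteq> K" "x \<notin> K"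
      and max: "\<And>H. \<lbrakk>submodule H R M; K \<subseteq> H; x \<notin> H\<rbrakk> \<Longrightarrow> H = K"
    using ex_maximal_submodule_avoiding[OF N x(2)] by blast
  have carr: "m \<in> carrier M" if "m \<in> K" for m
    using that submoduleE(1)[OF K(1)] by blast
  \<comment> \<open>For \<open>y\<close> outside \<open>K\<close>, maximality forces
    \<open>x\<close> into \<open>adjoin K y\<close>. The coefficient of \<open>y\<close> there is
    nonzero because \<open>x\<close> is not in \<open>K\<close>, so the equation can be solved for
    \<open>y\<close>.\<close>
  have span: "\<exists>c\<in>carrier R. \<exists>m\<in>K. y = m \<oplus>\<^bsub>M\<^esub> c \<odot>\<^bsub>M\<^esub> x" if y: "y \<in> carrier M" for y
  proof (cases "y \<in> K")
    case True
    then show ?thesis using adjoin_superset[OF K(1) x(1)] unfolding adjoin_def by blast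
  next
    case False
    then have "x \<in> adjoin K y"
      using max[OF adjoin_submodule[OF K(1) y] adjoin_superset[OF K(1) y]] adjoin_self[OF K(1) y]
      by blast
    then obtain m c where m: "m \<in> K" "c \<in> carrier R" "x = m \<oplus>\<^bsub>M\<^esub> c \<odot>\<^bsub>M\<^esub> y"
      unfolding adjoin_def by blast
    then have "c \<noteq> \<zero>" using K(3) carr y by auto
    then have c: "inv c \<in> carrier R" "inv c \<otimes> c = \<one>"
      using m(2) R.field_Units by auto
    have "inv c \<odot>\<^bsub>M\<^esub> x = inv c \<odot>\<^bsub>M\<^esub> m \<oplus>\<^bsub>M\<^esub> y"
      unfolding m(3) using m(1,2) c carr y
      by (simp add: smult_r_distr smult_assoc1[symmetric])
    then have "y = \<ominus>\<^bsub>M\<^esub> (inv c \<odot>\<^bsub>M\<^esub> m) \<oplus>\<^bsub>M\<^esub> inv c \<odot>\<^bsub>M\<^esub> x"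
      using m(1) c(1) carr y by (simp add: M.r_neg M.a_ac)
    moreover have "\<ominus>\<^bsub>M\<^esub> (inv c \<odot>\<^bsub>M\<^esub> m) \<in> K"
      using submoduleE(3,4)[OF K(1)] m(1) c(1) by blast
    ultimately show ?thesis using c(1) by blast
  qed
  \<comment> \<open>Two different coefficients would put \<open>(c - d) x\<close>, and after
    division \<open>x\<close> itself, into \<open>K\<close>.\<close>
  have unique: "c = d"
    if "m \<in> K" "n \<in> K" "c \<in> carrier R" "d \<in> carrier R"
      "m \<oplus>\<^bsub>M\<^esub> c \<odot>\<^bsub>M\<^esub> x = n \<oplus>\<^bsub>M\<^esub> d \<odot>\<^bsub>M\<^esub> x" for m n c d
  proof (rule ccontr)
    assume "c \<noteq> d"
    then have "c \<ominus> d \<noteq> \<zero>"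
      using that R.minus_equality[of c "\<ominus> d"] by (auto simp: R.minus_eq)
    then have u: "inv (c \<ominus> d) \<in> carrier R" "inv (c \<ominus> d) \<otimes> (c \<ominus> d) = \<one>"
      using that R.field_Units by auto
    have "(c \<ominus> d) \<odot>\<^bsub>M\<^esub> x = n \<oplus>\<^bsub>M\<^esub> \<ominus>\<^bsub>M\<^esub> m"
    proof -
      have "c \<odot>\<^bsub>M\<^esub> x = \<ominus>\<^bsub>M\<^esub> m \<oplus>\<^bsub>M\<^esub> (n \<oplus>\<^bsub>M\<^esub> d \<odot>\<^bsub>M\<^esub> x)"
        using that x carr by (simp add: M.r_neg1 flip: that(5))
      then show ?thesis
        using that x carr
        by (simp add: R.minus_eq smult_l_distr smult_l_minus M.a_ac M.r_neg M.r_neg1 M.r_neg2)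
    qed
    also have "\<dots> \<in> K" using that submoduleE(3,5)[OF K(1)] by blast
    finally have "inv (c \<ominus> d) \<odot>\<^bsub>M\<^esub> ((c \<ominus> d) \<odot>\<^bsub>M\<^esub> x) \<in> K"
      using submoduleE(4)[OF K(1)] u(1) by blast
    then show False using that u x K(3) by (simp add: smult_assoc1[symmetric])
  qed
  define f where "f y = (THE c. c \<in> carrier R \<and> (\<exists>m\<in>K. y = m \<oplus>\<^bsub>M\<^esub> c \<odot>\<^bsub>M\<^esub> x))" for y
  have f: "f (m \<oplus>\<^bsub>M\<^esub> c \<odot>\<^bsub>M\<^esub> x) = c" if "m \<in> K" "c \<in> carrier R" for m c
    unfolding f_def by (rule the_equality) (use that unique in blast)+
  have "linear_form f"
    unfolding linear_form_def
  proof (intro conjI ballI Pi_I)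
    fix y assume "y \<in> carrier M"
    then obtain c m where y: "c \<in> carrier R" "m \<in> K" "y = m \<oplus>\<^bsub>M\<^esub> c \<odot>\<^bsub>M\<^esub> x" using span by blast
    then show "f y \<in> carrier R" using f by simp
    show "f (a \<odot>\<^bsub>M\<^esub> y) = a \<otimes> f y" if a: "a \<in> carrier R" for a
    proof -
      have "a \<odot>\<^bsub>M\<^esub> y = a \<odot>\<^bsub>M\<^esub> m \<oplus>\<^bsub>M\<^esub> (a \<otimes> c) \<odot>\<^bsub>M\<^esub> x"
        using a y x carr by (simp add: smult_r_distr smult_assoc1)
      then show ?thesis using f a y submoduleE(4)[OF K(1)] by simp
    qed
    fix z assume "z \<in> carrier M"
    then obtain d n where z: "d \<in> carrier R" "n \<in> K" "z = n \<oplus>\<^bsub>M\<^esub> d \<odot>\<^bsub>M\<^esub> x" using span by blast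
    have "y \<oplus>\<^bsub>M\<^esub> z = (m \<oplus>\<^bsub>M\<^esub> n) \<oplus>\<^bsub>M\<^esub> (c \<oplus> d) \<odot>\<^bsub>M\<^esub> x"
      using y z x carr by (simp add: smult_l_distr M.a_ac)
    then show "f (y \<oplus>\<^bsub>M\<^esub> z) = f y \<oplus> f z" using f y z submoduleE(5)[OF K(1)] by simp
  qed
  moreover have "f y = \<zero>" if "y \<in> N" for y
    using f[of y \<zero>] that K(2) carr x(1) by auto
  moreover have "f x = \<one>"
    using f[OF submodule_zero[OF K(1)] R.one_closed] x(1) by simp
  ultimately show ?thesis by blast
qed

end

section \<open>Presented Lie algebras\<close>

text \<open>\<open>E\<close> may be arbitrary, since the rule \<open>relation\<close> takes up only
  pairs of expressions over \<open>G\<close>. The ring structure keeps the scalars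
  \<open>-1\<close>, \<open>c + d\<close> and \<open>c d\<close> of the axiom rules in the
  carrier.\<close>

lemma lie_cong_exprs:
  assumes "cring F" "(s, t) \<in> lie_cong F G E"
  shows "s \<in> lie_exprs F G \<and> t \<in> lie_exprs F G"
proof -
  interpret cring F by fact
  from assms(2) show ?thesis
    by induction (auto intro!: lie_exprs.intros simp: Neg_def)
qed

lemma equiv_lie_cong:
  assumes "cring F"
  shows "equiv (lie_exprs F G) (lie_cong F G E)"
proof (rule equivI)
  show "lie_cong F G E \<subseteq> lie_exprs F G \<times> lie_exprs F G"
    by (auto dest: lie_cong_exprs[OF assms])
qed (auto simp: refl_on_def sym_def trans_def intro: lie_cong.refl lie_cong.sym lie_cong.trans)

locale lie_presentation = cring F for F :: "('a, 'r) ring_scheme" (structure) +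
  fixes G :: "'g set" and E :: "(('a, 'g) lie_expr \<times> ('a, 'g) lie_expr) set"
begin

abbreviation "P \<equiv> lie_presented F G E"

definition cl :: "('a, 'g) lie_expr \<Rightarrow> ('a, 'g) lie_expr set" where
  "cl s = lie_cong F G E `` {s}"

lemma cl_eqI: "(s, t) \<in> lie_cong F G E \<Longrightarrow> cl s = cl t"
  unfolding cl_def by (rule equiv_class_eq[OF equiv_lie_cong[OF cring_axioms]])

lemma mem_cl: "t \<in> cl s \<longleftrightarrow> (s, t) \<in> lie_cong F G E"
  unfolding cl_def by simp

lemma carrier_presented: "carrier P = cl ` lie_exprs F G"
  unfolding lie_presented_def quotient_def cl_def by auto

lemma cl_closed [simp, intro]: "s \<in> lie_exprs F G \<Longrightarrow> cl s \<in> carrier P"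
  by (simp add: carrier_presented)

lemma zero_presented: "\<zero>\<^bsub>P\<^esub> = cl Zero"
  unfolding lie_presented_def cl_def by simp

text \<open>The operations of \<open>lie_presented\<close> combine all representatives at once. The
  congruence rules send all results into one class, so that computing with single representatives is
  legitimate.\<close>

lemma add_cl:
  assumes "s \<in> lie_exprs F G" "t \<in> lie_exprs F G"
  shows "cl s \<oplus>\<^bsub>P\<^esub> cl t = cl (Plus s t)"
proof -
  have "cl s \<oplus>\<^bsub>P\<^esub> cl t = lie_cong F G E `` {Plus s' t' | s' t'. s' \<in> cl s \<and> t' \<in> cl t}"
    by (simp add: lie_presented_def)
  also have "\<dots> = cl (Plus s t)"
    using assms
    by (auto simp: mem_cl)
      (blast intro: lie_cong.refl lie_cong.sym lie_cong.trans lie_cong.Plus_cong)+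
  finally show ?thesis .
qed

lemma smult_cl:
  assumes "c \<in> carrier F" "s \<in> lie_exprs F G"
  shows "c \<odot>\<^bsub>P\<^esub> cl s = cl (Scale c s)"
proof -
  have "c \<odot>\<^bsub>P\<^esub> cl s = lie_cong F G E `` {Scale c s' | s'. s' \<in> cl s}"
    by (simp add: lie_presented_def)
  also have "\<dots> = cl (Scale c s)"
    using assms
    by (auto simp: mem_cl)
      (blast intro: lie_cong.refl lie_cong.sym lie_cong.trans lie_cong.Scale_cong)+
  finally show ?thesis .
qed

lemma module_presented: "module F P"
proof (rule moduleI)
  show "abelian_group P"
  proof (rule abelian_groupI)
    fix x y z assume "x \<in> carrier P" "y \<in> carrier P" "z \<in> carrier P"
    then obtain s t u where "s \<in> lie_exprs F G" "t \<in> lie_exprs F G" "u \<in> lie_exprs F G"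
        and "x = cl s" "y = cl t" "z = cl u"
      by (auto simp: carrier_presented)
    then show "x \<oplus>\<^bsub>P\<^esub> y \<oplus>\<^bsub>P\<^esub> z = x \<oplus>\<^bsub>P\<^esub> (y \<oplus>\<^bsub>P\<^esub> z)"
      by (simp add: add_cl lie_exprs.Plus cl_eqI lie_cong.Plus_assoc)
  next
    fix x y assume "x \<in> carrier P" "y \<in> carrier P"
    then obtain s t where "s \<in> lie_exprs F G" "t \<in> lie_exprs F G" "x = cl s" "y = cl t"
      by (auto simp: carrier_presented)
    then show "x \<oplus>\<^bsub>P\<^esub> y = y \<oplus>\<^bsub>P\<^esub> x"
      by (simp add: add_cl cl_eqI lie_cong.Plus_commute)
  next
    fix x assume "x \<in> carrier P"
    then obtain s where s: "s \<in> lie_exprs F G" "x = cl s" by (auto simp: carrier_presented)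
    have neg: "Neg F s \<in> lie_exprs F G"
      using s(1) by (auto simp: Neg_def intro: lie_exprs.intros)
    \<comment> \<open>\<open>abelian_groupI\<close> asks for a left neutral element and left
      inverses, while \<open>lie_cong\<close> has the right-hand versions;
      \<open>Plus_commute\<close> mediates.\<close>
    have "cl Zero \<oplus>\<^bsub>P\<^esub> cl s = cl (Plus s Zero)"
      using s(1) by (auto simp: add_cl lie_exprs.Zero intro!: cl_eqI lie_cong.Plus_commute)
    then show "\<zero>\<^bsub>P\<^esub> \<oplus>\<^bsub>P\<^esub> x = x"
      using s by (auto simp: zero_presented intro!: cl_eqI lie_cong.Plus_Zero)
    have "cl (Neg F s) \<oplus>\<^bsub>P\<^esub> cl s = cl (Plus s (Neg F s))"
      using s(1) neg by (auto simp: add_cl intro!: cl_eqI lie_cong.Plus_commute)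
    also have "\<dots> = \<zero>\<^bsub>P\<^esub>"
      using s(1) by (auto simp: zero_presented intro!: cl_eqI lie_cong.Plus_Neg)
    finally show "\<exists>y\<in>carrier P. y \<oplus>\<^bsub>P\<^esub> x = \<zero>\<^bsub>P\<^esub>"
      using neg s(2) by blast
  qed (auto simp: carrier_presented zero_presented add_cl intro: lie_exprs.intros)
next
  fix a b x assume "a \<in> carrier F" "b \<in> carrier F" "x \<in> carrier P"
  moreover from this obtain s where "s \<in> lie_exprs F G" "x = cl s"
    by (auto simp: carrier_presented)
  ultimately show "(a \<oplus> b) \<odot>\<^bsub>P\<^esub> x = a \<odot>\<^bsub>P\<^esub> x \<oplus>\<^bsub>P\<^esub> b \<odot>\<^bsub>P\<^esub> x"
    and "(a \<otimes> b) \<odot>\<^bsub>P\<^esub> x = a \<odot>\<^bsub>P\<^esub> (b \<odot>\<^bsub>P\<^esub> x)"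
    by (simp_all add: smult_cl add_cl lie_exprs.Scale cl_eqI lie_cong.Scale_add lie_cong.Scale_mult)
next
  fix a x y assume "a \<in> carrier F" "x \<in> carrier P" "y \<in> carrier P"
  moreover from this obtain s t where "s \<in> lie_exprs F G" "t \<in> lie_exprs F G" "x = cl s" "y = cl t"
    by (auto simp: carrier_presented)
  ultimately show "a \<odot>\<^bsub>P\<^esub> (x \<oplus>\<^bsub>P\<^esub> y) = a \<odot>\<^bsub>P\<^esub> x \<oplus>\<^bsub>P\<^esub> a \<odot>\<^bsub>P\<^esub> y"
    by (simp add: smult_cl add_cl lie_exprs.Scale lie_exprs.Plus cl_eqI lie_cong.Scale_Plus)
next
  fix x assume "x \<in> carrier P"
  then show "\<one> \<odot>\<^bsub>P\<^esub> x = x"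
    unfolding carrier_presented by (elim imageE) (simp add: smult_cl cl_eqI lie_cong.Scale_one)
qed (auto simp: carrier_presented smult_cl cring_axioms intro: lie_exprs.intros)

interpretation P: module F P
  by (rule module_presented)

text \<open>Evaluation of expressions in \<open>F\<close>, seen as a one-dimensional abelian Lie
  algebra: every bracket becomes zero.\<close>

primrec eval_abelian :: "('g \<Rightarrow> 'a) \<Rightarrow> ('a, 'g) lie_expr \<Rightarrow> 'a" where
  "eval_abelian h (Gen g) = h g"
| "eval_abelian h Zero = \<zero>"
| "eval_abelian h (Plus s t) = eval_abelian h s \<oplus> eval_abelian h t"
| "eval_abelian h (Scale c s) = c \<otimes> eval_abelian h s"
| "eval_abelian h (Brack s t) = \<zero>"

lemma eval_abelian_closed:
  assumes "h \<in> G \<rightarrow> carrier F" "s \<in> lie_exprs F G"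
  shows "eval_abelian h s \<in> carrier F"
  using assms(2,1) by induction auto

text \<open>\<open>F\<close> with zero bracket satisfies the Lie algebra axioms, so every axiom rule
  preserves the value and only the pairs in \<open>E\<close> have to be checked.\<close>

lemma eval_abelian_cong:
  assumes h: "h \<in> G \<rightarrow> carrier F"
    and E: "\<And>s t. (s, t) \<in> E \<Longrightarrow> s \<in> lie_exprs F G \<Longrightarrow> t \<in> lie_exprs F G \<Longrightarrow>
              eval_abelian h s = eval_abelian h t"
    and "(s, t) \<in> lie_cong F G E"
  shows "eval_abelian h s = eval_abelian h t"
  using assms(3)
proof induction
  case (Plus_Neg s)
  then show ?case using eval_abelian_closed[OF h] by (simp add: Neg_def l_minus r_neg)
qed (auto simp: E eval_abelian_closed[OF h] a_ac m_assoc l_distr r_distr)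

text \<open>The universal property of the presentation, for maps into the abelian Lie algebra
  \<open>F\<close>.\<close>

lemma ex_linear_form_presented:
  assumes h: "h \<in> G \<rightarrow> carrier F"
    and E: "\<And>s t. (s, t) \<in> E \<Longrightarrow> s \<in> lie_exprs F G \<Longrightarrow> t \<in> lie_exprs F G \<Longrightarrow>
              eval_abelian h s = eval_abelian h t"
  shows "\<exists>\<phi>. P.linear_form \<phi> \<and> (\<forall>g\<in>G. \<phi> (cl (Gen g)) = h g)"
proof -
  \<comment> \<open>Evaluation is constant on a class, so the image of a class is a singleton and
    \<open>the_elem\<close> extracts the common value.\<close>
  define \<phi> where "\<phi> A = the_elem (eval_abelian h ` A)" for A
  have \<phi>: "\<phi> (cl s) = eval_abelian h s" if "s \<in> lie_exprs F G" for s
  proof -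
    have "eval_abelian h ` cl s = {eval_abelian h s}"
      using that lie_cong.refl[OF that] eval_abelian_cong[OF h E] by (force simp: mem_cl)
    then show ?thesis by (simp add: \<phi>_def)
  qed
  have "P.linear_form \<phi>"
    unfolding P.linear_form_def carrier_presented
    by (auto simp: \<phi> add_cl smult_cl lie_exprs.Plus lie_exprs.Scale eval_abelian_closed[OF h])
  then show ?thesis by (auto simp: \<phi> lie_exprs.Gen)
qed

end

section \<open>The tensor square\<close>

context lie_algebra
begin

abbreviation "D \<equiv> derived_subalgebra F L"
abbreviation "T \<equiv> tensor_square F L"
abbreviation tensor_infix (infixl \<open>\<boxtimes>\<close> 75) where "l \<boxtimes> k \<equiv> tensor F L l k"

lemma derived_submodule: "submodule D F L"
  unfolding derived_subalgebra_def by (rule L.submodule_generated_is_submodule) auto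

lemma bracket_in_derived:
  "\<lbrakk>x \<in> carrier L; y \<in> carrier L\<rbrakk> \<Longrightarrow> \<langle>x, y\<rangle>\<^bsub>L\<^esub> \<in> D"
  unfolding derived_subalgebra_def by (rule subsetD[OF L.submodule_generated_superset]) blast

lemma derived_carrier: "x \<in> D \<Longrightarrow> x \<in> carrier L"
  using L.submoduleE(1)[OF derived_submodule] by blast

lemma bracket_antisym:
  assumes "x \<in> carrier L" "y \<in> carrier L"
  shows "\<langle>x, y\<rangle>\<^bsub>L\<^esub> = \<ominus>\<^bsub>L\<^esub> \<langle>y, x\<rangle>\<^bsub>L\<^esub>"
proof -
  have "\<langle>x, y\<rangle>\<^bsub>L\<^esub> \<oplus>\<^bsub>L\<^esub> \<langle>y, x\<rangle>\<^bsub>L\<^esub> = \<langle>x \<oplus>\<^bsub>L\<^esub> y, x \<oplus>\<^bsub>L\<^esub> y\<rangle>\<^bsub>L\<^esub>"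
    using assms bracket_self[of x] bracket_self[of y]
    by (simp add: bracket_add_left bracket_add_right L.M.a_comm)
  also have "\<dots> = \<zero>\<^bsub>L\<^esub>" using assms by (simp add: bracket_self)
  finally show ?thesis using assms by (simp add: L.M.minus_equality)
qed

section \<open>The defining relations as identities between tensors\<close>

sublocale TP: lie_presentation F "carrier L \<times> carrier L" "tensor_relations F L" ..

lemma tensor_square_eq: "TP.P = T"
  by (simp add: tensor_square_def)

lemma tensor_eq: "TP.cl (Gen (l, k)) = l \<boxtimes> k"
  by (simp add: TP.cl_def tensor_def)

sublocale T: module F T
  using TP.module_presented by (simp add: tensor_square_eq)

lemma tensor_closed [simp, intro]:
  "\<lbrakk>l \<in> carrier L; k \<in> carrier L\<rbrakk> \<Longrightarrow> l \<boxtimes> k \<in> carrier T"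
  using TP.cl_closed[of "Gen (l, k)"] by (simp add: tensor_eq tensor_square_eq lie_exprs.Gen)

text \<open>The tensor relations contain \<open>Plus\<close>, \<open>Scale\<close> and
  \<open>Neg\<close> of generators; this lemma and the next two turn these into the operations of
  \<open>T\<close>.\<close>

lemma cl_Plus_Gen:
  "\<lbrakk>a \<in> carrier L; b \<in> carrier L; s \<in> lie_exprs F (carrier L \<times> carrier L)\<rbrakk> \<Longrightarrow>
   TP.cl (Plus (Gen (a, b)) s) = a \<boxtimes> b \<oplus>\<^bsub>T\<^esub> TP.cl s"
  by (simp add: tensor_eq lie_exprs.Gen flip: TP.add_cl tensor_square_eq)

lemma cl_Scale_Gen:
  "\<lbrakk>c \<in> carrier F; a \<in> carrier L; b \<in> carrier L\<rbrakk> \<Longrightarrow>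
   TP.cl (Scale c (Gen (a, b))) = c \<odot>\<^bsub>T\<^esub> (a \<boxtimes> b)"
  by (simp add: tensor_eq lie_exprs.Gen flip: TP.smult_cl tensor_square_eq)

lemma cl_Neg_Gen:
  "\<lbrakk>a \<in> carrier L; b \<in> carrier L\<rbrakk> \<Longrightarrow> TP.cl (Neg F (Gen (a, b))) = \<ominus>\<^bsub>T\<^esub> (a \<boxtimes> b)"
  by (simp add: Neg_def cl_Scale_Gen T.smult_l_minus)

lemma cl_relation:
  "\<lbrakk>(s, t) \<in> tensor_relations F L; s \<in> lie_exprs F (carrier L \<times> carrier L);
    t \<in> lie_exprs F (carrier L \<times> carrier L)\<rbrakk> \<Longrightarrow> TP.cl s = TP.cl t"
  by (rule TP.cl_eqI, rule lie_cong.relation)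

lemma tensor_scale_left:
  assumes "c \<in> carrier F" "l \<in> carrier L" "k \<in> carrier L"
  shows "(c \<odot>\<^bsub>L\<^esub> l) \<boxtimes> k = c \<odot>\<^bsub>T\<^esub> (l \<boxtimes> k)"
  using cl_relation[OF tensor_relations.scale_left[OF assms]] assms
  by (simp add: lie_exprs.intros cl_Scale_Gen tensor_eq)

lemma tensor_scale_right:
  assumes "c \<in> carrier F" "l \<in> carrier L" "k \<in> carrier L"
  shows "l \<boxtimes> (c \<odot>\<^bsub>L\<^esub> k) = c \<odot>\<^bsub>T\<^esub> (l \<boxtimes> k)"
  using cl_relation[OF tensor_relations.scale_right[OF assms]] assms
  by (simp add: lie_exprs.intros cl_Scale_Gen tensor_eq)

lemma tensor_add_left:
  assumes "l \<in> carrier L" "l' \<in> carrier L" "k \<in> carrier L"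
  shows "(l \<oplus>\<^bsub>L\<^esub> l') \<boxtimes> k = l \<boxtimes> k \<oplus>\<^bsub>T\<^esub> l' \<boxtimes> k"
  using cl_relation[OF tensor_relations.add_left[OF assms]] assms
  by (simp add: lie_exprs.intros cl_Plus_Gen tensor_eq)

lemma tensor_add_right:
  assumes "l \<in> carrier L" "k \<in> carrier L" "k' \<in> carrier L"
  shows "l \<boxtimes> (k \<oplus>\<^bsub>L\<^esub> k') = l \<boxtimes> k \<oplus>\<^bsub>T\<^esub> l \<boxtimes> k'"
  using cl_relation[OF tensor_relations.add_right[OF assms]] assms
  by (simp add: lie_exprs.intros cl_Plus_Gen tensor_eq)

lemma tensor_neg_left:
  "\<lbrakk>l \<in> carrier L; k \<in> carrier L\<rbrakk> \<Longrightarrow> (\<ominus>\<^bsub>L\<^esub> l) \<boxtimes> k = \<ominus>\<^bsub>T\<^esub> (l \<boxtimes> k)"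
  using tensor_scale_left[of "\<ominus> \<one>" l k] by (simp add: L.smult_l_minus T.smult_l_minus)

lemma tensor_neg_right:
  "\<lbrakk>l \<in> carrier L; k \<in> carrier L\<rbrakk> \<Longrightarrow> l \<boxtimes> (\<ominus>\<^bsub>L\<^esub> k) = \<ominus>\<^bsub>T\<^esub> (l \<boxtimes> k)"
  using tensor_scale_right[of "\<ominus> \<one>" l k] by (simp add: L.smult_l_minus T.smult_l_minus)

lemma tensor_zero_left [simp]: "k \<in> carrier L \<Longrightarrow> \<zero>\<^bsub>L\<^esub> \<boxtimes> k = \<zero>\<^bsub>T\<^esub>"
  using tensor_scale_left[of \<zero> "\<zero>\<^bsub>L\<^esub>" k] by simp

lemma tensor_zero_right [simp]: "k \<in> carrier L \<Longrightarrow> k \<boxtimes> \<zero>\<^bsub>L\<^esub> = \<zero>\<^bsub>T\<^esub>"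
  using tensor_scale_right[of \<zero> k "\<zero>\<^bsub>L\<^esub>"] by simp

lemma Neg_exprs: "s \<in> lie_exprs F G \<Longrightarrow> Neg F s \<in> lie_exprs F G"
  by (simp add: Neg_def lie_exprs.Scale)

lemma tensor_bracket_left:
  assumes "l \<in> carrier L" "l' \<in> carrier L" "k \<in> carrier L"
  shows "\<langle>l, l'\<rangle>\<^bsub>L\<^esub> \<boxtimes> k = l \<boxtimes> \<langle>l', k\<rangle>\<^bsub>L\<^esub> \<oplus>\<^bsub>T\<^esub> \<ominus>\<^bsub>T\<^esub> (l' \<boxtimes> \<langle>l, k\<rangle>\<^bsub>L\<^esub>)"
  using cl_relation[OF tensor_relations.bracket_left[OF assms]] assms
  by (simp add: lie_exprs.intros Neg_exprs cl_Plus_Gen cl_Neg_Gen tensor_eq)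

lemma tensor_bracket_right:
  assumes "l \<in> carrier L" "k \<in> carrier L" "k' \<in> carrier L"
  shows "l \<boxtimes> \<langle>k, k'\<rangle>\<^bsub>L\<^esub> = \<langle>k', l\<rangle>\<^bsub>L\<^esub> \<boxtimes> k \<oplus>\<^bsub>T\<^esub> \<ominus>\<^bsub>T\<^esub> (\<langle>k, l\<rangle>\<^bsub>L\<^esub> \<boxtimes> k')"
  using cl_relation[OF tensor_relations.bracket_right[OF assms]] assms
  by (simp add: lie_exprs.intros Neg_exprs cl_Plus_Gen cl_Neg_Gen tensor_eq)

section \<open>Symmetrized tensors and squares on the derived subalgebra\<close>

lemma tensor_bracket_self:
  assumes "l \<in> carrier L" "k \<in> carrier L"
  shows "\<langle>l, k\<rangle>\<^bsub>L\<^esub> \<boxtimes> \<langle>l, k\<rangle>\<^bsub>L\<^esub> = \<zero>\<^bsub>T\<^esub>"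
proof -
  \<comment> \<open>The bracket of \<open>l \<boxtimes> k\<close> with itself is computed twice: it
    is zero by alternation, and relation (iv) with antisymmetry turns it into the tensor in
    question. The symmetrized rule would only give twice this tensor, which says nothing in
    characteristic two.\<close>
  let ?B = "Brack (Gen (l, k)) (Gen (l, k))"
  have "TP.cl ?B = TP.cl Zero"
    using assms by (auto intro!: TP.cl_eqI lie_cong.Brack_self lie_exprs.Gen)
  moreover have "TP.cl ?B = \<ominus>\<^bsub>T\<^esub> (\<langle>k, l\<rangle>\<^bsub>L\<^esub> \<boxtimes> \<langle>l, k\<rangle>\<^bsub>L\<^esub>)"
    using cl_relation[OF tensor_relations.bracket_bracket[OF assms assms]] assms
    by (simp add: lie_exprs.intros Neg_exprs cl_Neg_Gen)
  moreover have "\<dots> = \<langle>l, k\<rangle>\<^bsub>L\<^esub> \<boxtimes> \<langle>l, k\<rangle>\<^bsub>L\<^esub>"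
    using assms bracket_antisym[of k l] by (simp add: tensor_neg_left)
  ultimately show ?thesis
    by (simp add: TP.zero_presented flip: tensor_square_eq)
qed

text \<open>
  Expanding $[l,l'] \otimes k$ by the first rule of (iii) and then $l \otimes [l',k]$ by the second
  returns $[l,l'] \otimes k$ plus the claimed sum.
\<close>

lemma tensor_bracket_symmetrized:
  assumes "k \<in> carrier L" "l \<in> carrier L" "l' \<in> carrier L"
  shows "\<langle>k, l\<rangle>\<^bsub>L\<^esub> \<boxtimes> l' \<oplus>\<^bsub>T\<^esub> l' \<boxtimes> \<langle>k, l\<rangle>\<^bsub>L\<^esub> = \<zero>\<^bsub>T\<^esub>"
proof -
  let ?A = "\<langle>l, l'\<rangle>\<^bsub>L\<^esub> \<boxtimes> k" and ?B = "\<langle>k, l\<rangle>\<^bsub>L\<^esub> \<boxtimes> l'" and ?C = "l' \<boxtimes> \<langle>k, l\<rangle>\<^bsub>L\<^esub>"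
  have carr: "?A \<in> carrier T" "?B \<in> carrier T" "?C \<in> carrier T"
    using assms by auto
  have "?A = l \<boxtimes> \<langle>l', k\<rangle>\<^bsub>L\<^esub> \<oplus>\<^bsub>T\<^esub> ?C"
    using tensor_bracket_left[of l l' k] assms bracket_antisym[of l k]
    by (simp add: tensor_neg_right)
  also have "l \<boxtimes> \<langle>l', k\<rangle>\<^bsub>L\<^esub> = ?B \<oplus>\<^bsub>T\<^esub> ?A"
    using tensor_bracket_right[of l l' k] assms bracket_antisym[of l' l]
    by (simp add: tensor_neg_left)
  finally have "?A = ?A \<oplus>\<^bsub>T\<^esub> (?B \<oplus>\<^bsub>T\<^esub> ?C)"
    using carr by (simp add: T.M.a_ac)
  then show ?thesis
    using carr T.M.add.r_cancel_one' T.M.add.l_cancel_one' by (metis T.M.a_closed)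
qed

text \<open>For fixed \<open>y\<close> the condition is linear in \<open>d\<close>, so it passes
  from brackets to their span.\<close>

lemma tensor_derived_symmetrized:
  assumes d: "d \<in> D" and y: "y \<in> carrier L"
  shows "d \<boxtimes> y \<oplus>\<^bsub>T\<^esub> y \<boxtimes> d = \<zero>\<^bsub>T\<^esub>"
proof -
  let ?H = "{x \<in> carrier L. x \<boxtimes> y \<oplus>\<^bsub>T\<^esub> y \<boxtimes> x = \<zero>\<^bsub>T\<^esub>}"
  have "submodule ?H F L"
  proof (rule L.submoduleI', goal_cases)
    case (3 a b)
    then have "(a \<oplus>\<^bsub>L\<^esub> b) \<boxtimes> y \<oplus>\<^bsub>T\<^esub> y \<boxtimes> (a \<oplus>\<^bsub>L\<^esub> b)
        = (a \<boxtimes> y \<oplus>\<^bsub>T\<^esub> y \<boxtimes> a) \<oplus>\<^bsub>T\<^esub> (b \<boxtimes> y \<oplus>\<^bsub>T\<^esub> y \<boxtimes> b)"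
      using y by (clarsimp simp add: tensor_add_left tensor_add_right T.M.a_ac)
    then show ?case using 3 by simp
  next
    case (4 c x)
    then have x: "x \<in> carrier L" "x \<boxtimes> y \<oplus>\<^bsub>T\<^esub> y \<boxtimes> x = \<zero>\<^bsub>T\<^esub>" by auto
    have "(c \<odot>\<^bsub>L\<^esub> x) \<boxtimes> y \<oplus>\<^bsub>T\<^esub> y \<boxtimes> (c \<odot>\<^bsub>L\<^esub> x) = c \<odot>\<^bsub>T\<^esub> (x \<boxtimes> y \<oplus>\<^bsub>T\<^esub> y \<boxtimes> x)"
      using x(1) y 4(1) by (simp only: tensor_scale_left tensor_scale_right T.smult_r_distr tensor_closed)
    then show ?case using 4(1) x by simp
  qed (use y in auto)
  then have "D \<subseteq> ?H"
    unfolding derived_subalgebra_def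
    by (rule L.submodule_generated_least) (use y in \<open>auto simp: tensor_bracket_symmetrized\<close>)
  then show ?thesis using d by blast
qed

lemma tensor_diag_add:
  assumes "x \<in> carrier L" "y \<in> carrier L"
  shows "(x \<oplus>\<^bsub>L\<^esub> y) \<boxtimes> (x \<oplus>\<^bsub>L\<^esub> y)
    = x \<boxtimes> x \<oplus>\<^bsub>T\<^esub> y \<boxtimes> y \<oplus>\<^bsub>T\<^esub> (x \<boxtimes> y \<oplus>\<^bsub>T\<^esub> y \<boxtimes> x)"
  using assms by (simp add: tensor_add_left tensor_add_right T.M.a_ac)

text \<open>Squaring is not additive in general, but inside \<open>D\<close> the cross terms cancel
  by \<open>tensor_derived_symmetrized\<close>. Hence the elements of \<open>D\<close> with zero
  square form a submodule, and it contains all brackets.\<close>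

lemma tensor_derived_diag:
  assumes "d \<in> D"
  shows "d \<boxtimes> d = \<zero>\<^bsub>T\<^esub>"
proof -
  let ?H = "{x \<in> D. x \<boxtimes> x = \<zero>\<^bsub>T\<^esub>}"
  note [simp] = L.submoduleE(4,5)[OF derived_submodule]
  have "submodule ?H F L"
    by (rule L.submoduleI')
      (auto simp: derived_carrier L.submodule_zero[OF derived_submodule] tensor_diag_add
        tensor_derived_symmetrized tensor_scale_left tensor_scale_right)
  then have "D \<subseteq> ?H"
    unfolding derived_subalgebra_def[of F L]
    by (rule L.submodule_generated_least)
      (auto simp: tensor_bracket_self bracket_in_derived simp flip: derived_subalgebra_def)
  then show ?thesis using assms by blast
qed

section \<open>Product forms on the tensor square\<close>

definition vanishing_form :: "'b set \<Rightarrow> ('b \<Rightarrow> 'a) \<Rightarrow> bool" where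
  "vanishing_form N f \<longleftrightarrow> L.linear_form f \<and> (\<forall>x\<in>N. f x = \<zero>)"

lemma vanishing_form_simps:
  assumes "vanishing_form N f"
  shows "x \<in> carrier L \<Longrightarrow> f x \<in> carrier F"
    and "x \<in> N \<Longrightarrow> f x = \<zero>"
    and "\<lbrakk>x \<in> carrier L; y \<in> carrier L\<rbrakk> \<Longrightarrow> f (x \<oplus>\<^bsub>L\<^esub> y) = f x \<oplus> f y"
    and "\<lbrakk>c \<in> carrier F; x \<in> carrier L\<rbrakk> \<Longrightarrow> f (c \<odot>\<^bsub>L\<^esub> x) = c \<otimes> f x"
  using assms L.linear_form_closed L.linear_form_add L.linear_form_smult
  unfolding vanishing_form_def by auto

lemma vanishing_form_mono: "\<lbrakk>vanishing_form N f; N' \<subseteq> N\<rbrakk> \<Longrightarrow> vanishing_form N' f"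
  unfolding vanishing_form_def by blast

lemma ex_vanishing_form:
  assumes "submodule N F L" "x \<in> carrier L" "x \<notin> N"
  obtains f where "vanishing_form N f" "f x = \<one>"
  using L.ex_separating_linear_form[OF F.field_axioms assms] unfolding vanishing_form_def by blast

definition product_form :: "('b \<Rightarrow> 'a) \<Rightarrow> ('b \<Rightarrow> 'a) \<Rightarrow>
    (('a, 'b \<times> 'b) lie_expr set \<Rightarrow> 'a) \<Rightarrow> bool" where
  "product_form f g \<phi> \<longleftrightarrow> vanishing_form D f \<and> vanishing_form D g \<and> T.linear_form \<phi> \<and>
     (\<forall>l\<in>carrier L. \<forall>k\<in>carrier L. \<phi> (l \<boxtimes> k) = f l \<otimes> g k)"

text \<open>The function \<open>f l * g k\<close> on generators respects all relations: (i) and (ii)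
  are bilinearity, and in (iii) and (iv) every tensor has a bracket in one of its slots, where
  \<open>f\<close> or \<open>g\<close> vanishes.\<close>

lemma ex_product_form:
  assumes f: "vanishing_form D f" and g: "vanishing_form D g"
  obtains \<phi> where "product_form f g \<phi>"
proof -
  define h where "h = (\<lambda>(l, k). f l \<otimes> g k)"
  note [simp] = vanishing_form_simps[OF f] vanishing_form_simps[OF g]
  have gen: "l \<in> carrier L \<and> k \<in> carrier L"
    if "Gen (l, k) \<in> lie_exprs F (carrier L \<times> carrier L)" for l k
    using that by cases auto
  have "\<exists>\<phi>. module.linear_form F TP.P \<phi> \<and>
      (\<forall>p\<in>carrier L \<times> carrier L. \<phi> (TP.cl (Gen p)) = h p)"
  proof (rule TP.ex_linear_form_presented)
    show "h \<in> carrier L \<times> carrier L \<rightarrow> carrier F"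
      by (auto simp: h_def)
    fix s t assume "(s, t) \<in> tensor_relations F L"
    then show "TP.eval_abelian h s = TP.eval_abelian h t"
      by cases (auto simp: h_def Neg_def bracket_in_derived l_distr r_distr m_ac)
  qed
  then show ?thesis
    using that f g unfolding product_form_def tensor_square_eq
    by (auto simp: tensor_eq h_def)
qed

section \<open>Spans of squares and the common kernel of the product forms\<close>

definition killed :: "('a, 'b \<times> 'b) lie_expr set \<Rightarrow> bool" where
  "killed t \<longleftrightarrow> (\<forall>f g \<phi>. product_form f g \<phi> \<longrightarrow> \<phi> t = \<zero>)"

definition squares :: "'b set \<Rightarrow> ('a, 'b \<times> 'b) lie_expr set set" where
  "squares N = submodule_generated F T {x \<boxtimes> x | x. x \<in> N}"

lemma squares_submodule: "N \<subseteq> carrier L \<Longrightarrow> submodule (squares N) F T"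
  unfolding squares_def by (rule T.submodule_generated_is_submodule) auto

lemma squares_mono: "N \<subseteq> N' \<Longrightarrow> squares N \<subseteq> squares N'"
  unfolding squares_def by (rule T.submodule_generated_mono) blast

lemma square_in_squares: "x \<in> N \<Longrightarrow> x \<boxtimes> x \<in> squares N"
  unfolding squares_def by (rule subsetD[OF T.submodule_generated_superset]) blast

lemma squares_derived: "squares D = {\<zero>\<^bsub>T\<^esub>}"
proof
  have "submodule {\<zero>\<^bsub>T\<^esub>} F T" by (rule T.submoduleI') auto
  then show "squares D \<subseteq> {\<zero>\<^bsub>T\<^esub>}"
    unfolding squares_def by (rule T.submodule_generated_least) (auto simp: tensor_derived_diag)
  have "D \<subseteq> carrier L" using derived_carrier by blast
  then show "{\<zero>\<^bsub>T\<^esub>} \<subseteq> squares D"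
    using T.submodule_zero[OF squares_submodule] by blast
qed

text \<open>A generator \<open>x \<boxtimes> x\<close> has the value \<open>f x * g x\<close>, whose
  first factor is zero. Only \<open>f\<close> has to kill \<open>N\<close>, which leaves
  \<open>g\<close> free to test membership in \<open>D\<close>.\<close>

lemma product_form_squares:
  assumes "product_form f g \<phi>" "vanishing_form N f" "N \<subseteq> carrier L" "t \<in> squares N"
  shows "\<phi> t = \<zero>"
proof (rule T.linear_form_vanishes_on_generated)
  show "T.linear_form \<phi>" using assms(1) unfolding product_form_def by blast
  show "t \<in> submodule_generated F T {x \<boxtimes> x | x. x \<in> N}"
    using assms(4) unfolding squares_def .
  show "{x \<boxtimes> x | x. x \<in> N} \<subseteq> carrier T" using assms(3) by auto
  fix y assume "y \<in> {x \<boxtimes> x | x. x \<in> N}"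
  then obtain x where x: "x \<in> N" "y = x \<boxtimes> x" by blast
  moreover have "x \<in> carrier L" using x assms(3) by blast
  moreover have "g x \<in> carrier F"
    using assms(1) calculation(3) vanishing_form_simps(1) unfolding product_form_def by blast
  ultimately show "\<phi> y = \<zero>"
    using assms(1) vanishing_form_simps(2)[OF assms(2)] unfolding product_form_def by simp
qed

text \<open>The square of \<open>m + c e\<close> is the square of \<open>m\<close>, plus
  \<open>c * c\<close> times the square of \<open>e\<close>, plus cross terms in \<open>c m\<close>
  and \<open>e\<close>. The expression \<open>w q c m\<close> is linear in the triple of its
  arguments, so these tensors form a submodule.\<close>

lemma squares_adjoin:
  assumes N: "submodule N F L" and e: "e \<in> carrier L" and t: "t \<in> squares (L.adjoin N e)"
  obtains q c m where "q \<in> squares N" "c \<in> carrier F" "m \<in> N"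
    "t = q \<oplus>\<^bsub>T\<^esub> c \<odot>\<^bsub>T\<^esub> (e \<boxtimes> e) \<oplus>\<^bsub>T\<^esub> (m \<boxtimes> e \<oplus>\<^bsub>T\<^esub> e \<boxtimes> m)"
proof -
  define w where "w q c m = q \<oplus>\<^bsub>T\<^esub> c \<odot>\<^bsub>T\<^esub> (e \<boxtimes> e) \<oplus>\<^bsub>T\<^esub> (m \<boxtimes> e \<oplus>\<^bsub>T\<^esub> e \<boxtimes> m)" for q c m
  let ?W = "{w q c m | q c m. q \<in> squares N \<and> c \<in> carrier F \<and> m \<in> N}"
  have NL: "N \<subseteq> carrier L" using L.submoduleE(1)[OF N] .
  have [simp]: "m \<in> carrier L" if "m \<in> N" for m using that NL by blast
  note Q = squares_submodule[OF NL]
  have [simp]: "q \<in> carrier T" if "q \<in> squares N" for q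
    using that T.submoduleE(1)[OF Q] by blast
  note [simp] = L.submodule_zero[OF N] L.submoduleE(4,5)[OF N]
    T.submodule_zero[OF Q] T.submoduleE(4,5)[OF Q]
  have W: "w q c m \<in> ?W" if "q \<in> squares N" "c \<in> carrier F" "m \<in> N" for q c m
    using that by blast
  have "submodule ?W F T"
  proof (rule T.submoduleI')
    show "?W \<subseteq> carrier T" using e by (auto simp: w_def)
    have "\<zero>\<^bsub>T\<^esub> = w \<zero>\<^bsub>T\<^esub> \<zero> \<zero>\<^bsub>L\<^esub>" using e by (simp add: w_def)
    then show "\<zero>\<^bsub>T\<^esub> \<in> ?W" using W[of "\<zero>\<^bsub>T\<^esub>" \<zero> "\<zero>\<^bsub>L\<^esub>"] by simp
  next
    fix a b assume "a \<in> ?W" "b \<in> ?W"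
    then obtain q c m q' c' m' where 1: "q \<in> squares N" "c \<in> carrier F" "m \<in> N" "a = w q c m"
      "q' \<in> squares N" "c' \<in> carrier F" "m' \<in> N" "b = w q' c' m'" by blast
    then have "a \<oplus>\<^bsub>T\<^esub> b = w (q \<oplus>\<^bsub>T\<^esub> q') (c \<oplus> c') (m \<oplus>\<^bsub>L\<^esub> m')"
      using e by (simp add: w_def T.smult_l_distr tensor_add_left tensor_add_right T.M.a_ac)
    then show "a \<oplus>\<^bsub>T\<^esub> b \<in> ?W" using W 1 by simp
  next
    fix a x assume a: "a \<in> carrier F" and "x \<in> ?W"
    then obtain q c m where 1: "q \<in> squares N" "c \<in> carrier F" "m \<in> N" "x = w q c m" by blast
    then have "a \<odot>\<^bsub>T\<^esub> x = w (a \<odot>\<^bsub>T\<^esub> q) (a \<otimes> c) (a \<odot>\<^bsub>L\<^esub> m)"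
      using e a by (simp add: w_def T.smult_r_distr T.smult_assoc1 tensor_scale_left tensor_scale_right)
    then show "a \<odot>\<^bsub>T\<^esub> x \<in> ?W" using W a 1 by simp
  qed
  moreover have "{x \<boxtimes> x | x. x \<in> L.adjoin N e} \<subseteq> ?W"
  proof clarify
    fix x assume "x \<in> L.adjoin N e"
    then obtain m c where x: "m \<in> N" "c \<in> carrier F" "x = m \<oplus>\<^bsub>L\<^esub> c \<odot>\<^bsub>L\<^esub> e"
      unfolding L.adjoin_def by blast
    then have "x \<boxtimes> x = w (m \<boxtimes> m) (c \<otimes> c) (c \<odot>\<^bsub>L\<^esub> m)"
      using e by (simp add: w_def tensor_diag_add tensor_scale_left tensor_scale_right T.smult_assoc1)
    then show "\<exists>q d n. x \<boxtimes> x = w q d n \<and> q \<in> squares N \<and> d \<in> carrier F \<and> n \<in> N"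
      using x square_in_squares by (metis F.m_closed L.submoduleE(4)[OF N])
  qed
  ultimately have "t \<in> ?W"
    using t T.submodule_generated_least unfolding squares_def[of "L.adjoin N e"] by blast
  then show ?thesis using that unfolding w_def by blast
qed

text \<open>
  With a form \<open>f\<close> killing \<open>N\<close> and \<open>f e = 1\<close>, the form $f \otimes f$ reads off the coefficient of
  $e \otimes e$, and $g \otimes f$ reads off \<open>g m\<close>, so \<open>m\<close> lies in $L^2$.
\<close>

lemma killed_squares_adjoin:
  assumes N: "submodule N F L" "D \<subseteq> N" and e: "e \<in> carrier L"
    and IH: "\<And>q. \<lbrakk>q \<in> squares N; killed q\<rbrakk> \<Longrightarrow> q = \<zero>\<^bsub>T\<^esub>"
    and t: "t \<in> squares (L.adjoin N e)" "killed t"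
  shows "t = \<zero>\<^bsub>T\<^esub>"
proof (cases "e \<in> N")
  case True
  \<comment> \<open>No form separates \<open>e\<close> from \<open>N\<close> in this case, but then
    adjoining \<open>e\<close> adds nothing.\<close>
  then have "L.adjoin N e \<subseteq> N"
    using L.submoduleE(4,5)[OF N(1)] unfolding L.adjoin_def by blast
  then show ?thesis using IH t squares_mono by blast
next
  case False
  have NL: "N \<subseteq> carrier L" using L.submoduleE(1)[OF N(1)] .
  obtain f where f: "vanishing_form N f" "f e = \<one>"
    using ex_vanishing_form[OF N(1) e False] by blast
  note fD = vanishing_form_mono[OF f(1) N(2)]
  obtain q c m where qcm: "q \<in> squares N" "c \<in> carrier F" "m \<in> N"
    and teq: "t = q \<oplus>\<^bsub>T\<^esub> c \<odot>\<^bsub>T\<^esub> (e \<boxtimes> e) \<oplus>\<^bsub>T\<^esub> (m \<boxtimes> e \<oplus>\<^bsub>T\<^esub> e \<boxtimes> m)"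
    using squares_adjoin[OF N(1) e t(1)] by blast
  have m: "m \<in> carrier L" using qcm(3) NL by blast
  have q: "q \<in> carrier T" using qcm(1) T.submoduleE(1)[OF squares_submodule[OF NL]] by blast
  have fm: "f m = \<zero>" using vanishing_form_simps(2)[OF f(1) qcm(3)] .
  obtain \<phi> where \<phi>: "product_form f f \<phi>" using ex_product_form[OF fD fD] .
  have \<phi>': "T.linear_form \<phi>" "\<And>l k. \<lbrakk>l \<in> carrier L; k \<in> carrier L\<rbrakk> \<Longrightarrow> \<phi> (l \<boxtimes> k) = f l \<otimes> f k"
    using \<phi> unfolding product_form_def by auto
  have "\<phi> t = c"
    unfolding teq using e m q qcm(2) fm f(2) product_form_squares[OF \<phi> f(1) NL qcm(1)]
    by (simp add: \<phi>' T.linear_form_add[OF \<phi>'(1)] T.linear_form_smult[OF \<phi>'(1)])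
  then have c: "c = \<zero>" using t(2) \<phi> unfolding killed_def by simp
  have "m \<in> D"
  proof (rule ccontr)
    assume "m \<notin> D"
    then obtain g where g: "vanishing_form D g" "g m = \<one>"
      using ex_vanishing_form[OF derived_submodule m] by blast
    obtain \<psi> where \<psi>: "product_form f g \<psi>" using ex_product_form[OF fD g(1)] .
    have \<psi>': "T.linear_form \<psi>" "\<And>l k. \<lbrakk>l \<in> carrier L; k \<in> carrier L\<rbrakk> \<Longrightarrow> \<psi> (l \<boxtimes> k) = f l \<otimes> g k"
      using \<psi> unfolding product_form_def by auto
    \<comment> \<open>Here \<open>q\<close> goes to zero because \<open>f\<close> kills
      \<open>N\<close>, \<open>m \<boxtimes> e\<close> goes to \<open>f m * g e = 0\<close>, and
      \<open>e \<boxtimes> m\<close> goes to \<open>f e * g m = 1\<close>.\<close>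
    have "\<psi> t = \<one>"
      unfolding teq c using e m q fm f(2) g product_form_squares[OF \<psi> f(1) NL qcm(1)]
        vanishing_form_simps(1)[OF g(1) e]
      by (simp add: \<psi>' T.linear_form_add[OF \<psi>'(1)])
    then show False using t(2) \<psi> F.one_not_zero unfolding killed_def by metis
  qed
  \<comment> \<open>With \<open>m\<close> in \<open>D\<close> the two cross terms cancel by
    \<open>tensor_derived_symmetrized\<close>, which leaves an element covered by the induction
    hypothesis.\<close>
  then have "t = q"
    unfolding teq c using tensor_derived_symmetrized e m q by simp
  then show ?thesis using IH qcm(1) t(2) by blast
qed

text \<open>Induction on \<open>S\<close>: \<open>squares_derived\<close> is the base case, and
  \<open>killed_squares_adjoin\<close> handles each further vector.\<close>

lemma killed_squares_finite:
  assumes "finite S" "S \<subseteq> carrier L"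
    and "t \<in> squares (submodule_generated F L (D \<union> S))" "killed t"
  shows "t = \<zero>\<^bsub>T\<^esub>"
  using assms
proof (induction S arbitrary: t)
  case empty
  have "submodule_generated F L D \<subseteq> D"
    using L.submodule_generated_least[OF derived_submodule] by blast
  then have "t \<in> squares D" using empty squares_mono by auto
  then show ?case by (simp add: squares_derived)
next
  case (insert e S)
  let ?N = "submodule_generated F L (D \<union> S)"
  have DS: "D \<union> S \<subseteq> carrier L" using derived_carrier insert by blast
  note N = L.submodule_generated_is_submodule[OF DS]
  have sup: "D \<union> S \<subseteq> ?N" by (rule L.submodule_generated_superset)
  have e: "e \<in> carrier L" using insert by blast
  have "submodule_generated F L (D \<union> insert e S) \<subseteq> L.adjoin ?N e"
    by (rule L.submodule_generated_least[OF L.adjoin_submodule[OF N e]])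
      (use sup L.adjoin_superset[OF N e] L.adjoin_self[OF N e] in blast)
  then have "t \<in> squares (L.adjoin ?N e)" using insert.prems(2) squares_mono by blast
  then show ?case
    using killed_squares_adjoin[OF N _ e] insert sup by blast
qed

section \<open>Separation on the whole diagonal submodule\<close>

lemma tensor_diagonal_eq: "tensor_diagonal F L = squares (carrier L)"
  unfolding tensor_diagonal_def squares_def by simp

text \<open>The submodules \<open>A S\<close> for finite \<open>S\<close> form a directed family,
  two of them lying in the one for the union of the index sets. Their union is therefore a
  submodule, and it contains each generator \<open>x \<boxtimes> x\<close> through
  \<open>A {x}\<close>.\<close>

lemma tensor_diagonal_finite_support:
  assumes "t \<in> tensor_diagonal F L"
  obtains S where "finite S" "S \<subseteq> carrier L" "t \<in> squares (submodule_generated F L (D \<union> S))"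
proof -
  define A where "A S = squares (submodule_generated F L (D \<union> S))" for S
  have sub: "submodule (A S) F T" if "S \<subseteq> carrier L" for S
  proof -
    have "D \<union> S \<subseteq> carrier L" using that derived_carrier by blast
    from L.submodule_generated_is_submodule[OF this] show ?thesis
      unfolding A_def by (intro squares_submodule L.submoduleE(1))
  qed
  have mono: "A S \<subseteq> A S'" if "S \<subseteq> S'" for S S'
    unfolding A_def using that by (intro squares_mono L.submodule_generated_mono) blast
  let ?H = "{t. \<exists>S. finite S \<and> S \<subseteq> carrier L \<and> t \<in> A S}"
  have "submodule ?H F T"
  proof (rule T.submoduleI')
    show "?H \<subseteq> carrier T" using sub T.submoduleE(1) by blast
    show "\<zero>\<^bsub>T\<^esub> \<in> ?H" using T.submodule_zero[OF sub[of "{}"]] by blast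
    show "c \<odot>\<^bsub>T\<^esub> a \<in> ?H" if "c \<in> carrier F" "a \<in> ?H" for c a
      using that sub T.submoduleE(4) by blast
    fix a b assume "a \<in> ?H" "b \<in> ?H"
    then obtain S S' where S: "finite S" "S \<subseteq> carrier L" "a \<in> A S"
      "finite S'" "S' \<subseteq> carrier L" "b \<in> A S'" by blast
    then have "a \<in> A (S \<union> S')" "b \<in> A (S \<union> S')"
      using mono[of S "S \<union> S'"] mono[of S' "S \<union> S'"] by auto
    then have "a \<oplus>\<^bsub>T\<^esub> b \<in> A (S \<union> S')"
      using S by (intro T.submoduleE(5) sub) auto
    moreover have "finite (S \<union> S')" "S \<union> S' \<subseteq> carrier L" using S by auto
    ultimately show "a \<oplus>\<^bsub>T\<^esub> b \<in> ?H" by blast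
  qed
  moreover have "{x \<boxtimes> x | x. x \<in> carrier L} \<subseteq> ?H"
  proof clarify
    fix x assume "x \<in> carrier L"
    moreover have "x \<in> submodule_generated F L (D \<union> {x})"
      using L.submodule_generated_superset by blast
    then have "x \<boxtimes> x \<in> A {x}" unfolding A_def by (rule square_in_squares)
    ultimately show "\<exists>S. finite S \<and> S \<subseteq> carrier L \<and> x \<boxtimes> x \<in> A S"
      by (intro exI[of _ "{x}"]) auto
  qed
  ultimately have "tensor_diagonal F L \<subseteq> ?H"
    unfolding tensor_diagonal_def by (rule T.submodule_generated_least)
  with assms have "t \<in> ?H" by (rule subsetD[rotated])
  then show ?thesis using that unfolding A_def by blast
qed

lemma killed_tensor_diagonal:
  "\<lbrakk>t \<in> tensor_diagonal F L; killed t\<rbrakk> \<Longrightarrow> t = \<zero>\<^bsub>T\<^esub>"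
  using tensor_diagonal_finite_support killed_squares_finite by metis

section \<open>Comparison of the two centers\<close>

lemma wedge_eq_zero_iff:
  assumes "l \<in> carrier L" "k \<in> carrier L"
  shows "wedge F L l k = \<zero>\<^bsub>exterior_square F L\<^esub> \<longleftrightarrow> l \<boxtimes> k \<in> tensor_diagonal F L"
proof -
  have "subgroup (tensor_diagonal F L) (add_monoid T)"
    using submodule.axioms(1)[OF squares_submodule] by (simp add: tensor_diagonal_eq)
  \<comment> \<open>The zero of \<open>lie_quotient\<close> is the ideal itself, so the claim says
    that a coset equals the subgroup exactly if its representative lies in it.\<close>
  moreover have "\<zero>\<^bsub>exterior_square F L\<^esub> = tensor_diagonal F L"
    by (simp add: exterior_square_def lie_quotient_def)
  ultimately show ?thesis
    unfolding wedge_def using T.a_coset_join1 T.a_coset_join2 assms by auto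
qed

lemma tensor_center_subset_derived: "tensor_center F L \<subseteq> D"
proof (rule subsetI, rule ccontr)
  fix l assume "l \<in> tensor_center F L" and nD: "l \<notin> D"
  then have l: "l \<in> carrier L" "l \<boxtimes> l = \<zero>\<^bsub>T\<^esub>" by (auto simp: tensor_center_def)
  obtain f where f: "vanishing_form D f" "f l = \<one>"
    using ex_vanishing_form[OF derived_submodule l(1) nD] .
  obtain \<phi> where \<phi>: "product_form f f \<phi>" using ex_product_form[OF f(1) f(1)] .
  then have "\<phi> (l \<boxtimes> l) = \<one>" using l(1) f(2) by (simp add: product_form_def)
  moreover have "\<phi> (l \<boxtimes> l) = \<zero>"
    using \<phi> T.linear_form_zero l(2) by (simp add: product_form_def)
  ultimately show False by simp
qed

text \<open>The value \<open>f l * g k\<close> vanishes through its first factor.\<close>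

lemma killed_tensor_derived:
  assumes "l \<in> D" "k \<in> carrier L"
  shows "killed (l \<boxtimes> k)"
  unfolding killed_def product_form_def
  using assms derived_carrier by (clarsimp simp: vanishing_form_simps)

theorem exterior_center_derived_eq_tensor_center: "exterior_center F L \<inter> D = tensor_center F L"
proof
  show "exterior_center F L \<inter> D \<subseteq> tensor_center F L"
    \<comment> \<open>A vanishing wedge puts \<open>l \<boxtimes> k\<close> into the diagonal
      submodule, and \<open>l\<close> in \<open>D\<close> makes it killed; both together force it to
      be zero.\<close>
    using killed_tensor_diagonal killed_tensor_derived
    by (auto simp: exterior_center_def tensor_center_def wedge_eq_zero_iff)
  have "\<zero>\<^bsub>T\<^esub> \<in> tensor_diagonal F L"
    using T.submodule_zero[OF squares_submodule] by (simp add: tensor_diagonal_eq)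
  \<comment> \<open>A tensor that is zero lies in the diagonal submodule, so its wedge vanishes
    too.\<close>
  then have "tensor_center F L \<subseteq> exterior_center F L"
    unfolding exterior_center_def tensor_center_def
    by (intro Collect_mono impI conjI ballI; clarify) (simp add: wedge_eq_zero_iff)
  then show "tensor_center F L \<subseteq> exterior_center F L \<inter> D"
    using tensor_center_subset_derived by blast
qed

end

theorem corollary2p7:
  fixes F :: "('a, 'r) ring_scheme" and L :: "('a, 'b, 'm) lie_scheme"
  assumes "lie_algebra F L"
    and "finite_dimensional F (lie_quotient L (derived_subalgebra F L))"
  shows "exterior_center F L \<inter> derived_subalgebra F L = tensor_center F L"
  using lie_algebra.exterior_center_derived_eq_tensor_center[OF assms(1)] .

end
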